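(* Let $\alpha\in(0,1]$, $\beta\ge 1-\alpha$, $A\in\mathbb{R}^{n\times n}$, $B\in\mathbb{R}^{n\times m}$, let $\psi$ be the initialization function of the system $\Sigma_{\alpha,\psi}$, let $T>0$, and suppose that the $\beta$-controllability Gramian $$Q_T=\int_0^T (T-t)^{2(1-\alpha-\beta)}\,\Phi_\beta(T-t)BB^*\Phi_\beta^*(T-t)\,dt$$ is nonsingular. For $b\in\mathbb{R}^n$ put $f_T(\psi,b)=-b-\int_0^T\Phi_\beta(T-\tau)\psi(\tau)\,d\tau$. Then: (a) for every $b\in\mathbb{R}^n$ the control law $$\overline{u}(t)=-(T-t)^{2(1-\alpha-\beta)}B^*\Phi_\beta^*(T-t)Q_T^{-1}f_T(\psi,b)$$ drives the system to $b$ in time $T$, i.e. $M_\beta(T,\psi,\overline{u})=b$; (b) among all controls $u\in L^2_\alpha([0,T],\mathbb{R}^m)$ driving the system to $b$ in time $T$ (i.e. $M_\beta(T,\psi,u)=b$), the control $\overline{u}$ minimizes the modified energy integral $$\mathcal{E}^{\alpha,\beta}(u)=\int_0^T\bigl|(T-t)^{\alpha+\beta-1}u(t)\bigr|^2dt .$$ Moreover, $$\mathcal{E}^{\alpha,\beta}(\overline{u})=\int_0^T\bigl|(T-t)^{\alpha+\beta-1}\overline{u}(t)\bigr|^2dt=\bigl\langle Q_T^{-1}f_T(\psi,b),\,f_T(\psi,b)\bigr\rangle ,$$ where $\langle\cdot,\cdot\rangle$ is the inner product.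
   Context: System: $\Sigma_{\alpha,\psi}$ is the initialized fractional linear control system $D^\alpha_{0+}x(t)=Ax(t)+Bu(t)$, $t\ge 0$, $x(t)\in\mathbb{R}^n$, $u(t)\in\mathbb{R}^m$, where $D^\alpha_{0+}x={}_0d^\alpha_t x+\psi$, ${}_0d^\alpha_t x=\mathcal{L}^{-1}[s^\alpha\mathcal{L}[x](s)]$ is the uninitialized derivative, and $\psi$ is a given $\mathbb{R}^n$-valued initialization function, integrable on $[0,T]$. Its forward trajectory is $\gamma(t,\psi,u)=\int_0^t e_\alpha^{A(t-\tau)}(Bu(\tau)-\psi(\tau))\,d\tau$, with $e_\alpha^{At}=\sum_{k\ge0}A^k\frac{t^{(k+1)\alpha-1}}{\Gamma((k+1)\alpha)}$. Memory: the memory of order $\beta$ at time $t$ is $M_\beta(t,\psi,u)=I^\beta_{0+}\gamma(t,\psi,u)$, where $I^\beta_{0+}\varphi(t)=\frac1{\Gamma(\beta)}\int_0^t\varphi(\tau)(t-\tau)^{\beta-1}d\tau$ for $\beta>0$ and $I^0_{0+}$ is the identity; it is given by, and here understood as, $$M_\beta(t,\psi,u)=\int_0^t\Phi_\beta(t-\tau)\bigl(Bu(\tau)-\psi(\tau)\bigr)d\tau,\qquad \Phi_\beta(t)=t^{\alpha+\beta-1}\sum_{k=0}^\infty A^k\frac{t^{k\alpha}}{\Gamma((k+1)\alpha+\beta)} .$$ A control $u$ on $[0,T]$ "drives the system to $b$ in time $T$" if $M_\beta(T,\psi,u)=b$. $L^2_\alpha([0,T],\mathbb{R}^m)$ denotes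 the measurable functions $u:[0,T]\to\mathbb{R}^m$ for which $t\mapsto(T-t)^{\alpha+\beta-1}u(t)$ is square integrable on $[0,T]$. The symbol $^*$ denotes matrix transpose and $|\cdot|$ the Euclidean norm. *)

theory Defs
  imports "HOL-Analysis.Analysis"
begin

(* Powers with respect to the matrix product; the type class power on vectors
   of vectors is the componentwise one. *)
primrec matpow :: "real^'n^'n \<Rightarrow> nat \<Rightarrow> real^'n^'n" where
  "matpow A 0 = mat 1"
| "matpow A (Suc k) = A ** matpow A k"

(* Only the values for t > 0 are meaningful. At t = 0 the convention 0 powr 0 = 0
   of powr may differ from the usual one, but below this kernel is only used
   under integrals and in functions of time considered up to null sets. *)
definition Phi :: "real \<Rightarrow> real \<Rightarrow> real^'n^'n \<Rightarrow> real \<Rightarrow> real^'n^'n" where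
  "Phi \<alpha> \<beta> A t =
     t powr (\<alpha> + \<beta> - 1) *\<^sub>R
       (\<Sum>k. (t powr (real k * \<alpha>) / Gamma ((real k + 1) * \<alpha> + \<beta>)) *\<^sub>R matpow A k)"

definition memory_integrand ::
  "real \<Rightarrow> real \<Rightarrow> real^'n^'n \<Rightarrow> real^'m^'n \<Rightarrow> real \<Rightarrow> (real \<Rightarrow> real^'n) \<Rightarrow> (real \<Rightarrow> real^'m) \<Rightarrow>
     real \<Rightarrow> real^'n" where
  "memory_integrand \<alpha> \<beta> A B t \<psi> u \<tau> = Phi \<alpha> \<beta> A (t - \<tau>) *v (B *v u \<tau> - \<psi> \<tau>)"

definition memory ::
  "real \<Rightarrow> real \<Rightarrow> real^'n^'n \<Rightarrow> real^'m^'n \<Rightarrow> real \<Rightarrow> (real \<Rightarrow> real^'n) \<Rightarrow> (real \<Rightarrow> real^'m) \<Rightarrow>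
     real^'n" where
  "memory \<alpha> \<beta> A B t \<psi> u = (LINT \<tau>|lebesgue_on {0..t}. memory_integrand \<alpha> \<beta> A B t \<psi> u \<tau>)"

(* The Bochner integral is 0 for non-integrable functions, so the existence of the
   memory integral is required explicitly. *)
definition drives ::
  "real \<Rightarrow> real \<Rightarrow> real^'n^'n \<Rightarrow> real^'m^'n \<Rightarrow> (real \<Rightarrow> real^'n) \<Rightarrow> real \<Rightarrow> (real \<Rightarrow> real^'m) \<Rightarrow>
     real^'n \<Rightarrow> bool" where
  "drives \<alpha> \<beta> A B \<psi> T u b \<longleftrightarrow>
     integrable (lebesgue_on {0..T}) (memory_integrand \<alpha> \<beta> A B T \<psi> u) \<and>
     memory \<alpha> \<beta> A B T \<psi> u = b"

definition L2_weighted :: "real \<Rightarrow> real \<Rightarrow> real \<Rightarrow> (real \<Rightarrow> real^'m) set" where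
  "L2_weighted \<alpha> \<beta> T =
     {u. u \<in> borel_measurable (lebesgue_on {0..T}) \<and>
         integrable (lebesgue_on {0..T}) (\<lambda>t. (norm ((T - t) powr (\<alpha> + \<beta> - 1) *\<^sub>R u t))\<^sup>2)}"

definition modified_energy :: "real \<Rightarrow> real \<Rightarrow> real \<Rightarrow> (real \<Rightarrow> real^'m) \<Rightarrow> real" where
  "modified_energy \<alpha> \<beta> T u =
     (LINT t|lebesgue_on {0..T}. (norm ((T - t) powr (\<alpha> + \<beta> - 1) *\<^sub>R u t))\<^sup>2)"

definition gramian ::
  "real \<Rightarrow> real \<Rightarrow> real^'n^'n \<Rightarrow> real^'m^'n \<Rightarrow> real \<Rightarrow> real^'n^'n" where
  "gramian \<alpha> \<beta> A B T =
     (LINT t|lebesgue_on {0..T}.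
        (T - t) powr (2 * (1 - \<alpha> - \<beta>)) *\<^sub>R
          (Phi \<alpha> \<beta> A (T - t) ** B ** transpose B ** transpose (Phi \<alpha> \<beta> A (T - t))))"

definition f_offset ::
  "real \<Rightarrow> real \<Rightarrow> real^'n^'n \<Rightarrow> real \<Rightarrow> (real \<Rightarrow> real^'n) \<Rightarrow> real^'n \<Rightarrow> real^'n" where
  "f_offset \<alpha> \<beta> A T \<psi> b =
     - b - (LINT \<tau>|lebesgue_on {0..T}. Phi \<alpha> \<beta> A (T - \<tau>) *v \<psi> \<tau>)"

definition optimal_control ::
  "real \<Rightarrow> real \<Rightarrow> real^'n^'n \<Rightarrow> real^'m^'n \<Rightarrow> real \<Rightarrow> (real \<Rightarrow> real^'n) \<Rightarrow> real^'n \<Rightarrow>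
     real \<Rightarrow> real^'m" where
  "optimal_control \<alpha> \<beta> A B T \<psi> b t =
     - ((T - t) powr (2 * (1 - \<alpha> - \<beta>)) *\<^sub>R
          (transpose B *v (transpose (Phi \<alpha> \<beta> A (T - t)) *v
            (matrix_inv (gramian \<alpha> \<beta> A B T) *v f_offset \<alpha> \<beta> A T \<psi> b))))"

end

theory Submission
  imports Defs
begin

text \<open>
  Write \<open>\<Phi>\<^sub>\<beta>(t) = t\<^bsup>\<alpha>+\<beta>-1\<^esup> S(t)\<close>, where \<open>S\<close> is a Mittag-Leffler series: it is bounded on
  compact intervals because \<open>\<Gamma>(x + \<alpha>) \<ge> (x - 1)\<^bsup>\<alpha>\<^esup> \<Gamma>(x)\<close> by log-convexity. In terms of the
  weighted control \<open>z(t) = (T - t)\<^bsup>\<alpha>+\<beta>-1\<^esup> u(t)\<close> and \<open>W(t) = S(T - t) B\<close> all singular weights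
  disappear: the control enters the memory as \<open>\<integral> W z\<close>, the Gramian is \<open>\<integral> W W\<^sup>*\<close>, the energy is
  \<open>\<integral> \<bar>z\<bar>\<^sup>2\<close>, and the optimal control becomes \<open>v = - W\<^sup>* q\<close> with \<open>Q\<^sub>T q = f\<^sub>T\<close>. Every admissible
  \<open>z\<close> satisfies \<open>\<integral> z \<bullet> v = q \<bullet> f\<^sub>T = \<integral> \<bar>v\<bar>\<^sup>2\<close>, so that \<open>\<bar>z\<bar>\<^sup>2 \<ge> 2 z \<bullet> v - \<bar>v\<bar>\<^sup>2\<close> gives minimality.
\<close>

section \<open>Growth of the Gamma function and a majorant series\<close>

lemma Gamma_real_add_ge:
  fixes a x :: real
  assumes "0 < a" "1 < x"
  shows "(x - 1) powr a * Gamma x \<le> Gamma (x + a)"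
proof -
  let ?f = "ln \<circ> Gamma :: real \<Rightarrow> real"
  \<comment> \<open>Convexity of \<open>ln \<circ> Gamma\<close>: its slope on [x - 1, x], which the
    functional equation evaluates to ln (x - 1), is at most its slope on [x, x + a].\<close>
  have I: "x - 1 \<in> {0<..}" "x + a \<in> {0<..}" "x - 1 < x" "x < x + a"
    using assms by auto
  note slope = convex_on_slope_le[OF log_convex_Gamma_real I]
  have "(?f (x - 1) - ?f x) / (x - 1 - x) \<le> (?f x - ?f (x + a)) / (x - (x + a))"
    using slope by linarith
  then have *: "a * (?f x - ?f (x - 1)) \<le> ?f (x + a) - ?f x"
    using assms by (simp add: field_simps)
  have pos: "Gamma x > 0" "Gamma (x - 1) > 0" "Gamma (x + a) > 0"
    using assms by (auto intro!: Gamma_real_pos)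
  have "Gamma x = (x - 1) * Gamma (x - 1)"
    using Gamma_plus1[of "x - 1"] nonpos_Ints_nonpos[of "x - 1"] assms by auto
  then have "ln (Gamma x) = ln (x - 1) + ln (Gamma (x - 1))"
    using ln_mult_pos[of "x - 1" "Gamma (x - 1)"] assms pos by simp
  with * have "a * ln (x - 1) + ln (Gamma x) \<le> ln (Gamma (x + a))"
    by (simp add: algebra_simps)
  then have "exp (a * ln (x - 1) + ln (Gamma x)) \<le> exp (ln (Gamma (x + a)))"
    by simp
  then show ?thesis
    using pos assms by (simp add: exp_add powr_def)
qed

lemma summable_power_div_Gamma:
  fixes a c C :: real
  assumes "0 < a" "0 < c"
  shows "summable (\<lambda>k. C ^ k / Gamma (real k * a + c))"
proof -
  \<comment> \<open>\<open>D\<close> solves D^a = 2|C| + 1. Once n a + c - 1 \<ge> D,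
    \<open>Gamma_real_add_ge\<close> bounds the ratio of consecutive terms by 1/2. The summand 1
    keeps \<open>D\<close> positive even if C = 0.\<close>
  define D where "D = (2 * \<bar>C\<bar> + 1) powr (1 / a)"
  obtain N :: nat where N: "(D + 2) / a < real N"
    using reals_Archimedean2 by blast
  have ratio: "norm (C ^ Suc n / Gamma (real (Suc n) * a + c))
      \<le> 1 / 2 * norm (C ^ n / Gamma (real n * a + c))" if "N \<le> n" for n
  proof -
    let ?x = "real n * a + c"
    have eq: "real (Suc n) * a + c = ?x + a"
      by (simp add: algebra_simps)
    have D0: "D > 0"
      unfolding D_def by simp
    have "(D + 2) / a < real n"
      using N that by linarith
    then have x: "?x - 1 \<ge> D" "?x > 1"
      using assms D0 by (simp_all add: field_simps)
    have "D powr a = 2 * \<bar>C\<bar> + 1"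
      unfolding D_def using assms by (simp add: powr_powr)
    moreover have "D powr a \<le> (?x - 1) powr a"
      using x D0 assms by (intro powr_mono2) auto
    ultimately have "2 * \<bar>C\<bar> \<le> (?x - 1) powr a"
      by linarith
    moreover have pos: "Gamma ?x > 0" "Gamma (?x + a) > 0"
      using x assms by (auto intro!: Gamma_real_pos)
    ultimately have "2 * \<bar>C\<bar> * Gamma ?x \<le> Gamma (?x + a)"
      using Gamma_real_add_ge[OF assms(1) x(2)] mult_right_mono[of "2 * \<bar>C\<bar>" "(?x - 1) powr a" "Gamma ?x"]
      by linarith
    then have "\<bar>C\<bar> / Gamma (?x + a) \<le> 1 / 2 * (1 / Gamma ?x)"
      using pos by (simp add: field_simps)
    from mult_left_mono[OF this, of "\<bar>C\<bar> ^ n"]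
    have "\<bar>C\<bar> ^ Suc n / Gamma (?x + a) \<le> 1 / 2 * (\<bar>C\<bar> ^ n / Gamma ?x)"
      by (simp add: algebra_simps)
    then show ?thesis
      unfolding eq using pos by (simp add: power_abs abs_mult)
  qed
  show ?thesis
    by (rule summable_ratio_test[of "1/2" N]) (use ratio in auto)
qed

section \<open>Bilinearity and norms of matrix products\<close>

lemma bounded_bilinear_matrix_matrix_mult:
  "bounded_bilinear ((**) :: real^'n^'m \<Rightarrow> real^'k^'n \<Rightarrow> real^'k^'m)"
  unfolding bilinear_conv_bounded_bilinear [symmetric] bilinear_def
  by (auto intro!: linearI simp: matrix_matrix_mult_def vec_eq_iff algebra_simps
      sum.distrib sum_distrib_left)

lemma bounded_bilinear_matrix_vector_mult:
  "bounded_bilinear ((*v) :: real^'n^'m \<Rightarrow> real^'n \<Rightarrow> real^'m)"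
  unfolding bilinear_conv_bounded_bilinear [symmetric] bilinear_def
  by (auto intro!: linearI simp: matrix_vector_mult_add_rdistrib matrix_vector_right_distrib
      matrix_vector_mult_scaleR scaleR_matrix_vector_assoc)

lemma bounded_linear_transpose: "bounded_linear (transpose :: real^'n^'m \<Rightarrow> real^'m^'n)"
  unfolding linear_conv_bounded_linear [symmetric]
  by (auto intro!: linearI simp: transpose_scalar) (simp add: transpose_def vec_eq_iff)

lemma matrix_scaleR_mult:
  fixes X :: "real^'n^'m" and Y :: "real^'k^'n"
  shows "(c *\<^sub>R X) ** Y = c *\<^sub>R (X ** Y)" "X ** (c *\<^sub>R Y) = c *\<^sub>R (X ** Y)"
  using bounded_bilinear.scaleR_left[OF bounded_bilinear_matrix_matrix_mult, of c X Y]
    bounded_bilinear.scaleR_right[OF bounded_bilinear_matrix_matrix_mult, of X c Y] by auto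

lemma matrix_mult_matrix_inv:
  fixes X :: "real^'n^'m"
  assumes "invertible X"
  shows "X ** matrix_inv X = mat 1"
  using someI_ex[of "\<lambda>Y. X ** Y = mat 1 \<and> Y ** X = mat 1"] assms
  unfolding matrix_inv_def invertible_def by blast

text \<open>Submultiplicativity up to a constant \<open>L\<close> suffices, with K =
  \<open>norm A * L\<close>. The factor \<open>norm (mat 1)\<close> appears because this norm is
  Euclidean in the entries, so the identity need not have norm 1.\<close>

lemma norm_matpow_le:
  fixes A :: "real^'n^'n"
  obtains K where "K \<ge> 0" "\<And>k. norm (matpow A k) \<le> norm (mat 1 :: real^'n^'n) * K ^ k"
proof -
  obtain L where L: "\<And>(X :: real^'n^'n) (Y :: real^'n^'n). norm (X ** Y) \<le> norm X * norm Y * L" "L > 0"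
    using bounded_bilinear.pos_bounded[OF bounded_bilinear_matrix_matrix_mult] by blast
  have "norm (matpow A k) \<le> norm (mat 1 :: real^'n^'n) * (norm A * L) ^ k" for k
  proof (induction k)
    case (Suc k)
    have "norm (matpow A (Suc k)) \<le> norm A * L * norm (matpow A k)"
      using L(1)[of A "matpow A k"] by (simp add: algebra_simps)
    also have "\<dots> \<le> norm A * L * (norm (mat 1 :: real^'n^'n) * (norm A * L) ^ k)"
      using Suc L(2) by (intro mult_left_mono) auto
    finally show ?case
      by (simp add: algebra_simps)
  qed simp
  then show ?thesis
    using that[of "norm A * L"] L(2) by auto
qed

section \<open>The regular factor of the kernel: for t > 0 the matrix Mittag-Leffler function
  E_{\<alpha>,\<alpha>+\<beta>}(t^\<alpha> A)\<close>

definition mittag_leffler :: "real \<Rightarrow> real \<Rightarrow> real^'n^'n \<Rightarrow> real \<Rightarrow> real^'n^'n" where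
  "mittag_leffler \<alpha> \<beta> A t =
     (\<Sum>k. (t powr (real k * \<alpha>) / Gamma ((real k + 1) * \<alpha> + \<beta>)) *\<^sub>R matpow A k)"

lemma Phi_eq_mittag_leffler:
  "Phi \<alpha> \<beta> A t = t powr (\<alpha> + \<beta> - 1) *\<^sub>R mittag_leffler \<alpha> \<beta> A t"
  unfolding Phi_def mittag_leffler_def ..

lemma borel_measurable_mittag_leffler [measurable]:
  "mittag_leffler \<alpha> \<beta> A \<in> borel_measurable borel"
  unfolding mittag_leffler_def by measurable

text \<open>Weierstrass majorant: replacing t by T and the matrix powers by K^k leaves the series of
  \<open>summable_power_div_Gamma\<close> with base T^\<alpha> K and offset \<alpha> +
  \<beta>.\<close>

lemma mittag_leffler_bounded:
  fixes A :: "real^'n^'n"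
  assumes "0 < \<alpha>" "1 \<le> \<alpha> + \<beta>"
  obtains C where "\<And>t. t \<in> {0..T} \<Longrightarrow> norm (mittag_leffler \<alpha> \<beta> A t) \<le> C"
proof -
  obtain K where K: "K \<ge> 0" "\<And>k. norm (matpow A k) \<le> norm (mat 1 :: real^'n^'n) * K ^ k"
    using norm_matpow_le by blast
  let ?N = "norm (mat 1 :: real^'n^'n)"
  define b where "b k = ?N * ((T powr \<alpha> * K) ^ k / Gamma (real k * \<alpha> + (\<alpha> + \<beta>)))" for k
  have sb: "summable b"
    unfolding b_def using assms by (intro summable_mult summable_power_div_Gamma) auto
  have "norm (mittag_leffler \<alpha> \<beta> A t) \<le> suminf b" if t: "t \<in> {0..T}" for t
  proof -
    let ?a = "\<lambda>k. (t powr (real k * \<alpha>) / Gamma ((real k + 1) * \<alpha> + \<beta>)) *\<^sub>R matpow A k"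
    have le: "norm (?a k) \<le> b k" for k
    proof -
      let ?x = "real k * \<alpha> + (\<alpha> + \<beta>)"
      have eq: "(real k + 1) * \<alpha> + \<beta> = ?x"
        by (simp add: algebra_simps)
      have "0 < ?x"
        by (rule add_nonneg_pos) (use assms in auto)
      then have pos: "Gamma ?x > 0"
        by (rule Gamma_real_pos)
      \<comment> \<open>Equality fails for T = 0 and k = 0: the left side is
        \<open>0 powr 0 = 0\<close>, the right side is 1.\<close>
      have "T powr (real k * \<alpha>) \<le> (T powr \<alpha>) ^ k"
        by (cases "T = 0") (auto simp: powr_power mult.commute)
      moreover have "t powr (real k * \<alpha>) \<le> T powr (real k * \<alpha>)"
        using t assms by (intro powr_mono2) auto
      ultimately have "t powr (real k * \<alpha>) / Gamma ?x * norm (matpow A k)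
          \<le> (T powr \<alpha>) ^ k / Gamma ?x * (?N * K ^ k)"
        using pos K by (intro mult_mono divide_right_mono) auto
      then show ?thesis
        unfolding eq b_def using pos by (simp add: power_mult_distrib mult_ac)
    qed
    then have "summable (\<lambda>k. norm (?a k))"
      by (intro summable_comparison_test'[OF sb, of 0]) auto
    then show ?thesis
      unfolding mittag_leffler_def
      using summable_norm[of ?a] suminf_le[OF le _ sb] by linarith
  qed
  then show ?thesis
    using that by blast
qed

section \<open>Minimum-energy controls for an abstract kernel \<open>W\<close> with Gramian
  \<open>G\<close>\<close>

lemma norm_transpose_mult_eq_inner:
  fixes X :: "real^'m^'n"
  shows "(norm (transpose X *v q))\<^sup>2 = q \<bullet> ((X ** transpose X) *v q)"
  by (simp add: power2_norm_eq_inner dot_lmul_matrix flip: matrix_vector_mul_assoc)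

context
  fixes M :: "'a measure" and W :: "'a \<Rightarrow> real^'m^'n" and G :: "real^'n^'n" and q F :: "real^'n"
  assumes int: "integrable M (\<lambda>t. W t ** transpose (W t))"
    and G: "G = (LINT t|M. W t ** transpose (W t))"
    and q: "G *v q = F"
begin

text \<open>The linear map X \<mapsto> \<open>X *v q\<close> commutes with the Gramian
  integral.\<close>

lemma gramian_control:
  "integrable M (\<lambda>t. W t *v (transpose (W t) *v q))"
  "(LINT t|M. W t *v (transpose (W t) *v q)) = F"
proof -
  have bl: "bounded_linear (\<lambda>X :: real^'n^'n. X *v q)"
    by (rule bounded_bilinear.bounded_linear_left[OF bounded_bilinear_matrix_vector_mult])
  show "integrable M (\<lambda>t. W t *v (transpose (W t) *v q))"
    using integrable_bounded_linear[OF bl int] by (simp only: matrix_vector_mul_assoc)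
  show "(LINT t|M. W t *v (transpose (W t) *v q)) = F"
    using integral_bounded_linear[OF bl int] G q by (simp only: matrix_vector_mul_assoc)
qed

lemma gramian_control_energy:
  "integrable M (\<lambda>t. (norm (transpose (W t) *v q))\<^sup>2)"
  "(LINT t|M. (norm (transpose (W t) *v q))\<^sup>2) = q \<bullet> F"
  using gramian_control
  by (simp_all only: norm_transpose_mult_eq_inner matrix_vector_mul_assoc
      integrable_inner_right integral_inner_right)

lemma gramian_control_minimal:
  assumes "integrable M (\<lambda>t. (norm (z t))\<^sup>2)" "integrable M (\<lambda>t. W t *v z t)"
    and "(LINT t|M. W t *v z t) = F"
  shows "q \<bullet> F \<le> (LINT t|M. (norm (z t))\<^sup>2)"
proof -
  let ?v = "\<lambda>t. transpose (W t) *v q"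
  have iq: "integrable M (\<lambda>t. q \<bullet> (W t *v z t))"
    using assms by simp
  \<comment> \<open>With the cross term written as q \<bullet> W z, its integrability and its
    integral q \<bullet> F come directly from the constraint on \<open>z\<close>; what remains is 2
    q \<bullet> F - q \<bullet> F.\<close>
  have "(LINT t|M. 2 * (q \<bullet> (W t *v z t)) - (norm (?v t))\<^sup>2) = q \<bullet> F"
    using assms gramian_control_energy iq
    by (simp only: Bochner_Integration.integral_diff integrable_mult_right integral_mult_right_zero
        integral_inner_right)
  moreover have "2 * (q \<bullet> (W t *v z t)) - (norm (?v t))\<^sup>2 \<le> (norm (z t))\<^sup>2" for t
  proof -
    have "q \<bullet> (W t *v z t) = ?v t \<bullet> z t"
      by (simp add: dot_lmul_matrix)
    moreover have "0 \<le> (norm (z t - ?v t))\<^sup>2"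
      by simp
    ultimately show ?thesis
      by (simp only: power2_norm_eq_inner inner_diff_left inner_diff_right)
        (simp add: inner_commute)
  qed
  ultimately show ?thesis
    using integral_mono[of M "\<lambda>t. 2 * (q \<bullet> (W t *v z t)) - (norm (?v t))\<^sup>2" "\<lambda>t. (norm (z t))\<^sup>2"]
      assms gramian_control_energy iq by auto
qed

end

section \<open>Integrability with bounded factors, and cancellation of weights\<close>

lemma measurable_lebesgue_on_borel:
  "f \<in> borel_measurable borel \<Longrightarrow> f \<in> borel_measurable (lebesgue_on S)"
  by (intro measurable_restrict_space1 measurable_completion) simp

lemma integrable_bounded_bilinear:
  fixes f :: "'a \<Rightarrow> 'b::euclidean_space" and g :: "'a \<Rightarrow> 'c::euclidean_space"
    and prod :: "'b \<Rightarrow> 'c \<Rightarrow> 'd::euclidean_space"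
  assumes "bounded_bilinear prod" and [measurable]: "f \<in> borel_measurable M"
    and f: "\<And>x. x \<in> space M \<Longrightarrow> norm (f x) \<le> C" and g: "integrable M g"
  shows "integrable M (\<lambda>x. prod (f x) (g x))"
proof -
  interpret bounded_bilinear prod by fact
  obtain K where K: "\<And>a b. norm (prod a b) \<le> norm a * norm b * K" "K > 0"
    using pos_bounded by blast
  have [measurable]: "g \<in> borel_measurable M"
    using g by simp
  have meas: "(\<lambda>x. prod (f x) (g x)) \<in> borel_measurable M"
    by (rule borel_measurable_continuous_Pair) (auto intro!: continuous_on continuous_intros)
  have "norm (prod (f x) (g x)) \<le> norm (C * K * norm (g x))" if "x \<in> space M" for x
  proof -
    have "norm (f x) * norm (g x) * K \<le> C * norm (g x) * K"
      using f[OF that] K(2) by (intro mult_right_mono) auto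
    then show ?thesis
      using K(1)[of "f x" "g x"] by (simp add: mult_ac)
  qed
  then show ?thesis
    by (intro Bochner_Integration.integrable_bound[OF _ meas, of "\<lambda>x. C * K * norm (g x)"])
      (use g in auto)
qed

text \<open>The weight w^(-2p) of the Gramian and of the control law meets two factors w^p. The
  exponents add up to 0, and \<open>0 powr 0 = 0\<close> forces the case distinction.\<close>

lemma powr_weight_cancel:
  fixes w p :: real
  shows "w powr (2 * - p) * w powr p * w powr p = (if w = 0 then 0 else 1)"
  by (simp flip: powr_add)

section \<open>Reduction of the fractional system to the weight-free problem\<close>

theorem theorem3p3:
  fixes \<alpha> \<beta> T :: real
    and A :: "real^'n^'n"
    and B :: "real^'m^'n"
    and \<psi> :: "real \<Rightarrow> real^'n"
  assumes "0 < \<alpha>" and "\<alpha> \<le> 1" and "\<beta> \<ge> 1 - \<alpha>" and "T > 0"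
    and "integrable (lebesgue_on {0..T}) \<psi>"
    and "invertible (gramian \<alpha> \<beta> A B T)"
  shows "\<forall>b. drives \<alpha> \<beta> A B \<psi> T (optimal_control \<alpha> \<beta> A B T \<psi> b) b \<and>
    optimal_control \<alpha> \<beta> A B T \<psi> b \<in> L2_weighted \<alpha> \<beta> T \<and>
    (\<forall>u \<in> L2_weighted \<alpha> \<beta> T. drives \<alpha> \<beta> A B \<psi> T u b \<longrightarrow>
        modified_energy \<alpha> \<beta> T (optimal_control \<alpha> \<beta> A B T \<psi> b) \<le> modified_energy \<alpha> \<beta> T u) \<and>
    modified_energy \<alpha> \<beta> T (optimal_control \<alpha> \<beta> A B T \<psi> b) =
      (matrix_inv (gramian \<alpha> \<beta> A B T) *v f_offset \<alpha> \<beta> A T \<psi> b) \<bullet> f_offset \<alpha> \<beta> A T \<psi> b"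
proof (intro allI)
  fix b :: "real^'n"
  let ?M = "lebesgue_on {0..T}"
  define p where "p = \<alpha> + \<beta> - 1"
  have p: "p \<ge> 0" "2 * (1 - \<alpha> - \<beta>) = 2 * - p" "\<alpha> + \<beta> - 1 = p"
    using assms(3) by (auto simp: p_def)
  let ?P = "\<lambda>t. Phi \<alpha> \<beta> A (T - t)"
  \<comment> \<open>At the single time \<open>t = T\<close> the convention \<open>0 powr 0 = 0\<close> makes the weights vanish rather
    than cancel, so \<open>R\<close> is set to \<open>0\<close> there to keep the identities below pointwise.\<close>
  define R where "R t = (if T - t = 0 then 0 else mittag_leffler \<alpha> \<beta> A (T - t))" for t
  define W where "W t = R t ** B" for t
  define G where "G = gramian \<alpha> \<beta> A B T"
  define F where "F = f_offset \<alpha> \<beta> A T \<psi> b"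
  define q where "q = matrix_inv G *v F"
  define u0 where "u0 = optimal_control \<alpha> \<beta> A B T \<psi> b"
  have Phi: "?P t = (T - t) powr p *\<^sub>R R t" for t
    by (simp add: Phi_eq_mittag_leffler p(3) R_def)
  interpret finite_measure ?M
    by (rule finite_measure_lebesgue_on) simp

  obtain C where C: "\<And>t. t \<in> {0..T} \<Longrightarrow> norm (mittag_leffler \<alpha> \<beta> A t) \<le> C"
    using mittag_leffler_bounded[of \<alpha> \<beta> T A] assms by auto
  \<comment> \<open>This makes the bound on \<open>R\<close> hold also at t = T, where
    \<open>R\<close> is 0 by definition.\<close>
  have "0 \<le> C"
    by (rule order_trans[OF norm_ge_zero C[of 0]]) (use assms(4) in auto)
  then have R_bound: "norm (R t) \<le> C" if "t \<in> space ?M" for t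
    using C[of "T - t"] that by (auto simp: R_def)
  have [measurable]: "R \<in> borel_measurable borel"
    unfolding R_def[abs_def] by measurable
  have R_meas: "R \<in> borel_measurable ?M"
    by (rule measurable_lebesgue_on_borel) measurable
  have P_meas: "?P \<in> borel_measurable ?M"
    unfolding Phi by (rule measurable_lebesgue_on_borel) measurable
  have P_bound: "norm (?P t) \<le> T powr p * C" if t: "t \<in> space ?M" for t
    unfolding Phi using R_bound[OF t] p(1) t
    by (auto intro!: mult_mono powr_mono2)
  \<comment> \<open>As p \<ge> 0, the kernel is bounded, so the \<psi> part of the memory can be
    integrated separately.\<close>
  have Ppsi: "integrable ?M (\<lambda>t. ?P t *v \<psi> t)"
    by (rule integrable_bounded_bilinear[OF bounded_bilinear_matrix_vector_mult P_meas P_bound assms(5)])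

  have gram_eq: "(T - t) powr (2 * (1 - \<alpha> - \<beta>)) *\<^sub>R
      (?P t ** B ** transpose B ** transpose (?P t)) = W t ** transpose (W t)" for t
  proof -
    have "(T - t) powr (2 * (1 - \<alpha> - \<beta>)) *\<^sub>R (?P t ** B ** transpose B ** transpose (?P t))
      = ((T - t) powr (2 * - p) * (T - t) powr p * (T - t) powr p) *\<^sub>R
          (R t ** B ** transpose B ** transpose (R t))"
      unfolding p(2) Phi
      by (simp add: transpose_scalar matrix_scaleR_mult)
    then show ?thesis
      unfolding powr_weight_cancel W_def
      by (simp add: matrix_transpose_mul matrix_mul_assoc R_def)
  qed
  have WW_int: "integrable ?M (\<lambda>t. W t ** transpose (W t))"
  proof -
    have "integrable ?M R"
      by (rule integrable_const_bound[where B = C]) (use R_bound R_meas in auto)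
    then have "integrable ?M (\<lambda>t. transpose (R t))"
      by (rule integrable_bounded_linear[OF bounded_linear_transpose])
    then have BR: "integrable ?M (\<lambda>t. (B ** transpose B) ** transpose (R t))"
      by (rule integrable_bounded_linear[OF bounded_bilinear.bounded_linear_right
            [OF bounded_bilinear_matrix_matrix_mult]])
    have "integrable ?M (\<lambda>t. R t ** ((B ** transpose B) ** transpose (R t)))"
      by (rule integrable_bounded_bilinear
          [OF bounded_bilinear_matrix_matrix_mult R_meas R_bound BR])
    then show ?thesis
      by (simp add: W_def matrix_transpose_mul matrix_mul_assoc)
  qed
  have G: "G = (LINT t|?M. W t ** transpose (W t))"
    unfolding G_def gramian_def gram_eq ..
  have Gq: "G *v q = F"
    using assms(6) unfolding q_def
    by (simp add: G_def matrix_vector_mul_assoc matrix_mult_matrix_inv)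
  \<comment> \<open>The control law carries a minus sign and must contribute -F to the memory, so
    the abstract results are applied to -q and -F; both signs cancel in the energy.\<close>
  then have Gq': "G *v (- q) = - F"
    by (simp add: bounded_bilinear.minus_right[OF bounded_bilinear_matrix_vector_mult])
  note ctrl = gramian_control[OF WW_int G Gq'] gramian_control_energy[OF WW_int G Gq']

  \<comment> \<open>The powers are -2p from the control law, p from \<open>Phi\<close> and p from
    the energy weight; at t = T both sides vanish.\<close>
  have weighted: "(T - t) powr p *\<^sub>R u0 t = transpose (W t) *v (- q)" for t
  proof -
    have "(T - t) powr p *\<^sub>R u0 t
      = - (((T - t) powr (2 * - p) * (T - t) powr p * (T - t) powr p) *\<^sub>R
          (transpose B *v (transpose (R t) *v q)))"
      unfolding u0_def optimal_control_def Phi p(2) q_def G_def F_def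
      by (simp add: transpose_scalar matrix_vector_mult_scaleR mult_ac
          flip: scaleR_matrix_vector_assoc del: transpose_matrix_vector)
    then show ?thesis
      unfolding powr_weight_cancel W_def
      by (simp add: R_def matrix_transpose_mul matrix_vector_mul_assoc
          linear_0[OF bounded_linear.linear[OF bounded_linear_transpose]]
          bounded_bilinear.minus_right[OF bounded_bilinear_matrix_vector_mult] del: transpose_matrix_vector)
  qed
  have PB: "?P t *v (B *v u t) = W t *v ((T - t) powr p *\<^sub>R u t)" for t u
    unfolding Phi W_def
    by (simp add: matrix_vector_mult_scaleR matrix_vector_mul_assoc matrix_scaleR_mult
        flip: scaleR_matrix_vector_assoc)
  have F: "(LINT t|?M. ?P t *v \<psi> t) = - b - F"
    unfolding F_def f_offset_def by simp
  have split: "memory_integrand \<alpha> \<beta> A B T \<psi> u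
      = (\<lambda>t. W t *v ((T - t) powr p *\<^sub>R u t) - ?P t *v \<psi> t)" for u
    unfolding memory_integrand_def by (simp add: matrix_vector_mult_diff_distrib PB)

  \<comment> \<open>Control part minus \<psi> part: -F - (-b - F) = b.\<close>
  have "drives \<alpha> \<beta> A B \<psi> T u0 b"
    unfolding drives_def memory_def split weighted
    using ctrl Ppsi F by (simp del: transpose_matrix_vector)
  moreover have "u0 \<in> L2_weighted \<alpha> \<beta> T"
  proof -
    have [measurable]: "(\<lambda>t. transpose B *v (transpose (R t) *v q)) \<in> borel_measurable borel"
      by (rule borel_measurable_continuous_on[where f = "\<lambda>X. transpose B *v (transpose X *v q)"])
        (auto intro!: linear_continuous_on bounded_linear_compose[OF matrix_vector_mul_bounded_linear]
          bounded_linear_compose[OF bounded_bilinear.bounded_linear_left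
            [OF bounded_bilinear_matrix_vector_mult] bounded_linear_transpose]
          simp del: transpose_matrix_vector)
    \<comment> \<open>Without the energy weight a net power -p remains, so \<open>u0\<close> may
      blow up at T; only its measurability is derived from this form.\<close>
    have "u0 = (\<lambda>t. - (((T - t) powr (2 * - p) * (T - t) powr p) *\<^sub>R
          (transpose B *v (transpose (R t) *v q))))"
      unfolding u0_def optimal_control_def Phi p(2) q_def G_def F_def
      by (simp add: fun_eq_iff transpose_scalar matrix_vector_mult_scaleR mult_ac
          flip: scaleR_matrix_vector_assoc del: transpose_matrix_vector)
    also have "\<dots> \<in> borel_measurable ?M"
      by (rule measurable_lebesgue_on_borel) measurable
    finally have "u0 \<in> borel_measurable ?M" .
    moreover have "integrable ?M (\<lambda>t. (norm ((T - t) powr p *\<^sub>R u0 t))\<^sup>2)"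
      unfolding weighted by (rule ctrl)
    ultimately show ?thesis
      unfolding L2_weighted_def p(3) by simp
  qed
  moreover have energy: "modified_energy \<alpha> \<beta> T u0 = q \<bullet> F"
    unfolding modified_energy_def p(3) weighted using ctrl by simp
  moreover have "modified_energy \<alpha> \<beta> T u0 \<le> modified_energy \<alpha> \<beta> T u"
    if u: "u \<in> L2_weighted \<alpha> \<beta> T" and d: "drives \<alpha> \<beta> A B \<psi> T u b" for u
  proof -
    let ?z = "\<lambda>t. (T - t) powr p *\<^sub>R u t"
    have "integrable ?M (\<lambda>t. (norm (?z t))\<^sup>2)"
      using u unfolding L2_weighted_def p(3) by simp
    \<comment> \<open>\<open>drives\<close> gives integrability of the difference only; adding the
      \<psi> part back isolates the control part.\<close>
    moreover have Wz: "integrable ?M (\<lambda>t. W t *v ?z t)"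
    proof -
      have "integrable ?M (\<lambda>t. (W t *v ?z t - ?P t *v \<psi> t) + ?P t *v \<psi> t)"
        using d Ppsi unfolding drives_def split by (intro Bochner_Integration.integrable_add) auto
      then show ?thesis
        by simp
    qed
    moreover have "(LINT t|?M. W t *v ?z t) = - F"
      using d Wz Ppsi F unfolding drives_def memory_def split
      by (simp add: eq_neg_iff_add_eq_0)
    ultimately have "- q \<bullet> - F \<le> (LINT t|?M. (norm (?z t))\<^sup>2)"
      by (rule gramian_control_minimal[OF WW_int G Gq'])
    then show ?thesis
      unfolding energy by (simp add: modified_energy_def p(3))
  qed
  ultimately show "drives \<alpha> \<beta> A B \<psi> T (optimal_control \<alpha> \<beta> A B T \<psi> b) b \<and>
    optimal_control \<alpha> \<beta> A B T \<psi> b \<in> L2_weighted \<alpha> \<beta> T \<and>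
    (\<forall>u \<in> L2_weighted \<alpha> \<beta> T. drives \<alpha> \<beta> A B \<psi> T u b \<longrightarrow>
        modified_energy \<alpha> \<beta> T (optimal_control \<alpha> \<beta> A B T \<psi> b) \<le> modified_energy \<alpha> \<beta> T u) \<and>
    modified_energy \<alpha> \<beta> T (optimal_control \<alpha> \<beta> A B T \<psi> b) =
      (matrix_inv (gramian \<alpha> \<beta> A B T) *v f_offset \<alpha> \<beta> A T \<psi> b) \<bullet> f_offset \<alpha> \<beta> A T \<psi> b"
    unfolding u0_def q_def F_def G_def by blast
qed

end
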